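(* Let $n\ge 4$, let $S=C(\lambda_1,\ldots,\lambda_{n-2})$ be a generalized Humbert curve of type $n$ with generalized Humbert group $H=\langle a_1,\ldots,a_n\rangle\cong\mathbb Z_2^n$ and standard generators $a_1,\ldots,a_{n+1}$. If $K$ is a non-trivial subgroup of $H$ acting freely on $S$, then there exist $r\in A_n$ and $P\in\mathcal F_r^n$ such that $K=K_P$.
   Context: Let $\lambda_1,\ldots,\lambda_{n-2}\in\mathbb C\setminus\{0,1\}$ be pairwise distinct. $C(\lambda_1,\ldots,\lambda_{n-2})\subset\mathbb P^n$ is the non-singular projective curve (closed Riemann surface) defined by the $n-1$ equations $$x_1^2+x_2^2+x_3^2=0,\quad \lambda_1x_1^2+x_2^2+x_4^2=0,\ \ldots,\ \lambda_{n-2}x_1^2+x_2^2+x_{n+1}^2=0.$$ For $j=1,\ldots,n+1$, $a_j$ is the automorphism of this curve obtained by changing the sign of the coordinate $x_j$. One has $a_1a_2\cdots a_{n+1}=1$, and $H=\langle a_1,\ldots,a_n\rangle\cong\mathbb Z_2^n$ is called the generalized Humbert group; $a_1,\ldots,a_{n+1}$ are its standard generators. They are exactly the non-trivial elements of $H$ that have fixed points on $S$. "Acting freely" means that no non-trivial element of the subgroup has a fixed point on $S$. For $r\in\{1,\ldots,n-1\}$ write $\mathbb Z_2^r=\{u_0=1,u_1,\ldots,u_{2^r-1}\}$ (multiplicatively). $\mathcal F_r^n$ is the set of tuples $P=(I_1,\ldots,I_{2^r-1})$ of pairwise disjoint sets (some possibly empty) with union $\{1,\ldots,n+1\}$ such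 that (i) $u_1^{\#I_1}\cdots u_{2^r-1}^{\#I_{2^r-1}}=1$, and (ii) $\langle u_k: I_k\ne\emptyset\rangle=\mathbb Z_2^r$. Set $A_n=\{r\in\{1,\ldots,n-1\}:\mathcal F_r^n\neq\emptyset\}$. For $r\in A_n$ and $P=(I_1,\ldots,I_{2^r-1})\in\mathcal F_r^n$, let $\rho_r:H\to\mathbb Z_2^r$ be the surjective homomorphism with $\rho_r(a_j)=u_k$ for $j\in I_k$, and let $K_P\cong\mathbb Z_2^{n-r}$ be its kernel. *)

theory Defs
  imports Complex_Main "HOL-Algebra.Algebra"
begin

section \<open>The curve in projective space\<close>

text \<open>
  A vector of complex numbers indexed by 1, ..., n+1 is a function on the natural numbers that
  vanishes outside this range.  A point of n-dimensional projective space is the class of a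
  non-zero vector modulo non-zero scalars, that is, a set of vectors.
\<close>

definition hom_coords :: "nat \<Rightarrow> (nat \<Rightarrow> complex) set" where
  "hom_coords n = {x. (\<forall>i. i \<notin> {1..n+1} \<longrightarrow> x i = 0) \<and> (\<exists>i\<in>{1..n+1}. x i \<noteq> 0)}"

definition proportional :: "nat \<Rightarrow> ((nat \<Rightarrow> complex) \<times> (nat \<Rightarrow> complex)) set" where
  "proportional n = {(x, y). x \<in> hom_coords n \<and> y \<in> hom_coords n \<and>
                             (\<exists>c. c \<noteq> 0 \<and> y = (\<lambda>i. c * x i))}"

definition proj_space :: "nat \<Rightarrow> (nat \<Rightarrow> complex) set set" where
  "proj_space n = hom_coords n // proportional n"

definition curve_equations :: "nat \<Rightarrow> (nat \<Rightarrow> complex) \<Rightarrow> (nat \<Rightarrow> complex) \<Rightarrow> bool" where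
  "curve_equations n lam x \<longleftrightarrow>
     (x 1)\<^sup>2 + (x 2)\<^sup>2 + (x 3)\<^sup>2 = 0 \<and>
     (\<forall>j\<in>{1..n-2}. lam j * (x 1)\<^sup>2 + (x 2)\<^sup>2 + (x (j + 3))\<^sup>2 = 0)"

definition humbert_curve :: "nat \<Rightarrow> (nat \<Rightarrow> complex) \<Rightarrow> (nat \<Rightarrow> complex) set set" where
  "humbert_curve n lam = {p \<in> proj_space n. \<forall>x\<in>p. curve_equations n lam x}"


section \<open>The generalized Humbert group\<close>

definition sign_change :: "nat \<Rightarrow> (nat \<Rightarrow> complex) \<Rightarrow> (nat \<Rightarrow> complex)" where
  "sign_change j x = x(j := - x j)"

text \<open>
  An automorphism of the curve is determined by its effect on points, and composition of
  automorphisms is composition of the maps on points.  The group generated by the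
  sign changes is therefore formed inside the group of bijections of the curve, whose elements
  are extensional functions.
\<close>

definition std_gen :: "nat \<Rightarrow> (nat \<Rightarrow> complex) \<Rightarrow> nat \<Rightarrow> ((nat \<Rightarrow> complex) set \<Rightarrow> (nat \<Rightarrow> complex) set)"
  where "std_gen n lam j = (\<lambda>p\<in>humbert_curve n lam. sign_change j ` p)"

definition humbert_group ::
    "nat \<Rightarrow> (nat \<Rightarrow> complex) \<Rightarrow> ((nat \<Rightarrow> complex) set \<Rightarrow> (nat \<Rightarrow> complex) set) monoid" where
  "humbert_group n lam = subgroup_generated (BijGroup (humbert_curve n lam)) (std_gen n lam ` {1..n})"

definition acts_freely :: "('p \<Rightarrow> 'p) set \<Rightarrow> 'p set \<Rightarrow> bool" where
  "acts_freely K S \<longleftrightarrow> (\<forall>g\<in>K. g \<noteq> \<one>\<^bsub>BijGroup S\<^esub> \<longrightarrow> (\<forall>p\<in>S. g p \<noteq> p))"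

text \<open>
  The sign changes are bijections of the curve, so none of them is discarded by the
  intersection with the carrier built into \<^const>\<open>subgroup_generated\<close>.
\<close>

lemma sign_change_sign_change [simp]: "sign_change j (sign_change j x) = x"
  by (simp add: sign_change_def)

lemma sign_change_hom_coords:
  assumes "x \<in> hom_coords n" "j \<in> {1..n+1}"
  shows "sign_change j x \<in> hom_coords n"
  using assms by (fastforce simp: hom_coords_def sign_change_def)

lemma sign_change_image_proj_space:
  assumes j: "j \<in> {1..n+1}" and p: "p \<in> proj_space n"
  shows "sign_change j ` p \<in> proj_space n"
proof -
  obtain x where x: "x \<in> hom_coords n" and p_eq: "p = proportional n `` {x}"
    using p unfolding proj_space_def by (auto elim: quotientE)
  have *: "(sign_change j a, sign_change j b) \<in> proportional n" if "(a, b) \<in> proportional n" for a b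
    using that j by (auto simp: proportional_def intro!: sign_change_hom_coords)
                    (auto simp: sign_change_def fun_eq_iff)
  have "sign_change j ` p = proportional n `` {sign_change j x}"
  proof (intro equalityI subsetI)
    fix y assume "y \<in> sign_change j ` p"
    then show "y \<in> proportional n `` {sign_change j x}"
      using * by (auto simp: p_eq)
  next
    fix y assume "y \<in> proportional n `` {sign_change j x}"
    then have "sign_change j y \<in> p"
      using *[of "sign_change j x" y] by (simp add: p_eq)
    then show "y \<in> sign_change j ` p"
      by (metis imageI sign_change_sign_change)
  qed
  then show ?thesis
    using sign_change_hom_coords[OF x j] by (auto simp: proj_space_def intro: quotientI)
qed

lemma sign_change_image_humbert_curve:
  assumes "j \<in> {1..n+1}" "p \<in> humbert_curve n lam"
  shows "sign_change j ` p \<in> humbert_curve n lam"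
proof -
  have sq: "(sign_change j x i)\<^sup>2 = (x i)\<^sup>2" for x i
    by (simp add: sign_change_def)
  have "curve_equations n lam (sign_change j x) \<longleftrightarrow> curve_equations n lam x" for x
    unfolding curve_equations_def sq ..
  then show ?thesis
    using assms by (auto simp: humbert_curve_def sign_change_image_proj_space)
qed

lemma std_gen_in_BijGroup:
  assumes "j \<in> {1..n+1}"
  shows "std_gen n lam j \<in> carrier (BijGroup (humbert_curve n lam))"
proof -
  have "bij_betw (std_gen n lam j) (humbert_curve n lam) (humbert_curve n lam)"
    by (rule bij_betwI[where g = "std_gen n lam j"])
       (use sign_change_image_humbert_curve[OF assms] in \<open>auto simp: std_gen_def image_image\<close>)
  then show ?thesis
    by (simp add: BijGroup_def Bij_def) (simp add: std_gen_def)
qed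


section \<open>Partitions labelled by an elementary abelian 2-group\<close>

definition Z2pow :: "nat \<Rightarrow> (nat \<Rightarrow> int) monoid" where
  "Z2pow r = product_group {1..r} (\<lambda>_. integer_mod_group 2)"

text \<open>
  The listing of the elements is arbitrary, except that the neutral element comes first.
\<close>

definition enumerates_Z2pow :: "nat \<Rightarrow> (nat \<Rightarrow> (nat \<Rightarrow> int)) \<Rightarrow> bool" where
  "enumerates_Z2pow r u \<longleftrightarrow> bij_betw u {0..2^r - 1} (carrier (Z2pow r)) \<and> u 0 = \<one>\<^bsub>Z2pow r\<^esub>"

definition part_family ::
    "nat \<Rightarrow> nat \<Rightarrow> (nat \<Rightarrow> (nat \<Rightarrow> int)) \<Rightarrow> (nat \<Rightarrow> nat set) set" where
  "part_family n r u =
     {P \<in> {1..2^r - 1} \<rightarrow>\<^sub>E Pow {1..n+1}.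
        disjoint_family_on P {1..2^r - 1} \<and>
        (\<Union>k\<in>{1..2^r - 1}. P k) = {1..n+1} \<and>
        (\<Otimes>\<^bsub>Z2pow r\<^esub>k\<in>{1..2^r - 1}. u k [^]\<^bsub>Z2pow r\<^esub> card (P k)) = \<one>\<^bsub>Z2pow r\<^esub> \<and>
        generate (Z2pow r) {u k |k. k \<in> {1..2^r - 1} \<and> P k \<noteq> {}} = carrier (Z2pow r)}"

definition admissible_ranks :: "nat \<Rightarrow> (nat \<Rightarrow> nat \<Rightarrow> (nat \<Rightarrow> int)) \<Rightarrow> nat set" where
  "admissible_ranks n u = {r \<in> {1..n-1}. part_family n r (u r) \<noteq> {}}"

text \<open>
  The homomorphism is pinned down as a function that is extensional on the Humbert group;
  on the group itself it is determined by its values on the generators.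
\<close>

definition part_hom ::
    "nat \<Rightarrow> (nat \<Rightarrow> complex) \<Rightarrow> nat \<Rightarrow> (nat \<Rightarrow> (nat \<Rightarrow> int)) \<Rightarrow> (nat \<Rightarrow> nat set) \<Rightarrow>
     ((nat \<Rightarrow> complex) set \<Rightarrow> (nat \<Rightarrow> complex) set) \<Rightarrow> (nat \<Rightarrow> int)" where
  "part_hom n lam r u P =
     (THE f. f \<in> epi (humbert_group n lam) (Z2pow r) \<and>
             f \<in> extensional (carrier (humbert_group n lam)) \<and>
             (\<forall>k\<in>{1..2^r - 1}. \<forall>j\<in>P k. f (std_gen n lam j) = u k))"

definition part_kernel ::
    "nat \<Rightarrow> (nat \<Rightarrow> complex) \<Rightarrow> nat \<Rightarrow> (nat \<Rightarrow> (nat \<Rightarrow> int)) \<Rightarrow> (nat \<Rightarrow> nat set) \<Rightarrow>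
     ((nat \<Rightarrow> complex) set \<Rightarrow> (nat \<Rightarrow> complex) set) set" where
  "part_kernel n lam r u P = kernel (humbert_group n lam) (Z2pow r) (part_hom n lam r u P)"

end

theory Submission
  imports Defs
begin

text \<open>
  The idea is to read the partition off the quotient of the Humbert group \<open>H\<close> by \<open>K\<close>.
  Sign changes commute and are involutions, so \<open>H\<close> is an elementary abelian 2-group, and its
  elements are the maps that change all signs in some subset of \<open>{1..n}\<close>
  (\<open>carrier_humbert_group\<close>).  Hence the quotient is isomorphic to \<open>Z2pow r\<close> for some \<open>r\<close>, and \<open>K\<close> is
  the kernel of an epimorphism \<open>\<rho>\<close> from \<open>H\<close> onto \<open>Z2pow r\<close> (\<open>subgroup_eq_kernel_Z2pow\<close>).  The set
  labelled \<open>u\<^sub>k\<close> consists of the indices \<open>j\<close> with \<open>\<rho> a\<^sub>j = u\<^sub>k\<close>.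

  Freeness of the action enters only through the standard generators: each \<open>a\<^sub>j\<close> is non-trivial
  and fixes the points of the curve with \<open>x\<^sub>j = 0\<close>, of which there is at least one, so \<open>a\<^sub>j\<close> does
  not lie in \<open>K\<close>.  Therefore \<open>\<rho> a\<^sub>j\<close> is never neutral, every index receives a label
  \<open>u\<^sub>k\<close> with \<open>k \<ge> 1\<close>, and \<open>r \<ge> 1\<close>.  Changing all \<open>n + 1\<close> signs multiplies a vector by \<open>-1\<close> and so
  fixes every projective point; applying \<open>\<rho>\<close> to this relation gives condition (i), and
  surjectivity of \<open>\<rho>\<close> gives condition (ii) (\<open>fibres_in_part_family\<close>).  The bound \<open>r < n\<close> is a count: \<open>H\<close>
  has at most \<open>2\<^sup>n\<close> elements, and \<open>K\<close> has at least two.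
\<close>

section \<open>Elementary abelian 2-groups\<close>

lemma comm_group_Z2pow: "comm_group (Z2pow r)"
proof -
  have "group (Z2pow r)"
    by (simp add: Z2pow_def)
  then show ?thesis
    by (rule group.group_comm_groupI) (auto simp: Z2pow_def add.commute)
qed

lemma group_Z2pow: "group (Z2pow r)"
  using comm_group_Z2pow by (rule comm_group.axioms(2))

lemma card_carrier_Z2pow: "card (carrier (Z2pow r)) = 2 ^ r"
  by (simp add: Z2pow_def card_PiE carrier_integer_mod_group)

lemma carrier_Z2pow: "carrier (Z2pow r) = ({1..r} \<rightarrow>\<^sub>E {0, 1})"
proof -
  have "carrier (integer_mod_group 2) = {0, 1}"
    by (auto simp: carrier_integer_mod_group)
  then show ?thesis
    by (simp add: Z2pow_def)
qed

text \<open>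
  This is the step that adjoins a basis vector: an element \<open>q\<close> outside the image of \<open>\<phi>\<close> becomes the
  image of the new last coordinate.  The extension stays injective because a relation
  \<open>\<phi> f \<otimes> q = \<one>\<close> would place \<open>q\<close> in the image.  Coordinates are added modulo 2, and exponent two
  makes this compatible with the multiplication of \<open>G\<close>.
\<close>

lemma (in comm_group) extend_mon_Z2pow:
  assumes exp2: "\<And>x. x \<in> carrier G \<Longrightarrow> x \<otimes> x = \<one>"
    and phi: "\<phi> \<in> mon (Z2pow r) G"
    and q: "q \<in> carrier G" "q \<notin> \<phi> ` carrier (Z2pow r)"
  shows "(\<lambda>f. \<phi> (restrict f {1..r}) \<otimes> (if f (Suc r) = 0 then \<one> else q)) \<in> mon (Z2pow (Suc r)) G"
    (is "?\<psi> \<in> _")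
proof -
  have phi_hom: "\<phi> \<in> hom (Z2pow r) G" and phi_inj: "inj_on \<phi> (carrier (Z2pow r))"
    using phi by (auto simp: mon_def)
  interpret Z: group "Z2pow r" by (rule group_Z2pow)
  interpret phi: group_hom "Z2pow r" G \<phi>
    using phi_hom by unfold_locales
  have res: "restrict f {1..r} \<in> carrier (Z2pow r)" if "f \<in> carrier (Z2pow (Suc r))" for f
    using that by (auto simp: carrier_Z2pow PiE_iff)
  have hom: "?\<psi> \<in> hom (Z2pow (Suc r)) G"
  proof (rule homI)
    fix f assume f: "f \<in> carrier (Z2pow (Suc r))"
    show "?\<psi> f \<in> carrier G"
      using res[OF f] q by auto
  next
    fix f g assume f: "f \<in> carrier (Z2pow (Suc r))" and g: "g \<in> carrier (Z2pow (Suc r))"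
    have "restrict (f \<otimes>\<^bsub>Z2pow (Suc r)\<^esub> g) {1..r} = restrict f {1..r} \<otimes>\<^bsub>Z2pow r\<^esub> restrict g {1..r}"
      by (auto simp: Z2pow_def fun_eq_iff)
    then have "\<phi> (restrict (f \<otimes>\<^bsub>Z2pow (Suc r)\<^esub> g) {1..r}) =
                 \<phi> (restrict f {1..r}) \<otimes> \<phi> (restrict g {1..r})"
      using res[OF f] res[OF g] by simp
    moreover have "(if (f \<otimes>\<^bsub>Z2pow (Suc r)\<^esub> g) (Suc r) = 0 then \<one> else q) =
                     (if f (Suc r) = 0 then \<one> else q) \<otimes> (if g (Suc r) = 0 then \<one> else q)"
    proof -
      have "(f \<otimes>\<^bsub>Z2pow (Suc r)\<^esub> g) (Suc r) = (f (Suc r) + g (Suc r)) mod 2"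
        by (simp add: Z2pow_def)
      moreover have "f (Suc r) \<in> {0, 1}" "g (Suc r) \<in> {0, 1}"
        using f g by (auto simp: carrier_Z2pow PiE_iff)
      ultimately show ?thesis
        using q exp2[of q] by auto
    qed
    ultimately show "?\<psi> (f \<otimes>\<^bsub>Z2pow (Suc r)\<^esub> g) = ?\<psi> f \<otimes> ?\<psi> g"
      using res[OF f] res[OF g] q by (simp add: m_ac)
  qed
  have "f = \<one>\<^bsub>Z2pow (Suc r)\<^esub>" if f: "f \<in> carrier (Z2pow (Suc r))" and f1: "?\<psi> f = \<one>" for f
  proof (cases "f (Suc r) = 0")
    case True
    then have "\<phi> (restrict f {1..r}) = \<phi> \<one>\<^bsub>Z2pow r\<^esub>"
      using f1 res[OF f] by simp
    then have "restrict f {1..r} = \<one>\<^bsub>Z2pow r\<^esub>"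
      using inj_onD[OF phi_inj _ res[OF f] Z.one_closed] by blast
    then have "f i = 0" if "i \<in> {1..r}" for i
      using that by (metis Z2pow_def one_integer_mod_group one_product_group restrict_apply')
    then have "f i = 0" if "i \<in> {1..Suc r}" for i
      using True that by (cases "i = Suc r") auto
    then show ?thesis
      using f by (auto simp: carrier_Z2pow Z2pow_def PiE_iff extensional_def fun_eq_iff)
  next
    case False
    then have "q \<otimes> \<phi> (restrict f {1..r}) = \<one>"
      using f1 res[OF f] q by (simp add: m_comm)
    then have "q = inv (\<phi> (restrict f {1..r}))"
      using q res[OF f] by (metis inv_equality phi.hom_closed)
    then have "q = \<phi> (inv\<^bsub>Z2pow r\<^esub> (restrict f {1..r}))"
      using res[OF f] by simp
    then show ?thesis
      using q(2) res[OF f] by blast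
  qed
  then show ?thesis
    using hom mon_iff_hom_one[OF group_Z2pow is_group] by blast
qed

text \<open>
  An embedding of \<open>Z2pow r\<close> with \<open>r\<close> as large as possible is onto, since otherwise
  \<open>extend_mon_Z2pow\<close> would enlarge it.  The largest \<open>r\<close> exists because \<open>2\<^sup>r\<close> cannot exceed the order of
  the finite group.
\<close>

lemma (in comm_group) exponent_two_iso_Z2pow:
  assumes fin: "finite (carrier G)" and exp2: "\<And>x. x \<in> carrier G \<Longrightarrow> x \<otimes> x = \<one>"
  shows "\<exists>r \<phi>. \<phi> \<in> iso (Z2pow r) G"
proof -
  define Q where "Q r \<longleftrightarrow> (\<exists>\<phi>. \<phi> \<in> mon (Z2pow r) G)" for r
  have "(\<lambda>_. \<one>) \<in> mon (Z2pow 0) G"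
    by (auto simp: mon_def hom_def carrier_Z2pow)
  then have Q0: "Q 0"
    unfolding Q_def by blast
  have bound: "r \<le> card (carrier G)" if Qr: "Q r" for r
  proof -
    obtain \<phi> where "\<phi> \<in> mon (Z2pow r) G"
      using Qr unfolding Q_def by blast
    then have "card (carrier (Z2pow r)) \<le> card (carrier G)"
      by (intro card_inj_on_le[of \<phi>] fin) (auto simp: mon_def hom_def)
    then show ?thesis
      using less_exp[of r] unfolding card_carrier_Z2pow by linarith
  qed
  define r where "r = Greatest Q"
  have "Q r"
    unfolding r_def using Q0 bound by (rule GreatestI_nat)
  have max: "s \<le> r" if "Q s" for s
    unfolding r_def using that bound by (rule Greatest_le_nat)
  from \<open>Q r\<close> obtain \<phi> where phi: "\<phi> \<in> mon (Z2pow r) G"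
    unfolding Q_def by blast
  have "\<phi> ` carrier (Z2pow r) = carrier G"
  proof (rule ccontr)
    assume "\<phi> ` carrier (Z2pow r) \<noteq> carrier G"
    moreover have "\<phi> ` carrier (Z2pow r) \<subseteq> carrier G"
      using phi by (auto simp: mon_def hom_def)
    ultimately obtain q where "q \<in> carrier G" "q \<notin> \<phi> ` carrier (Z2pow r)"
      by blast
    then have "Q (Suc r)"
      unfolding Q_def using extend_mon_Z2pow[OF exp2 phi] by blast
    then show False
      using max by fastforce
  qed
  then have "\<phi> \<in> iso (Z2pow r) G"
    using phi by (auto simp: mon_def iso_def bij_betw_def)
  then show ?thesis by blast
qed

lemma (in comm_group) finprod_in_generate:
  assumes f: "f ` A \<subseteq> carrier G" and T: "T \<subseteq> A"
  shows "(\<Otimes>j\<in>T. f j) \<in> generate G (f ` A)"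
  using T
proof (induction T rule: infinite_finite_induct)
  case (insert j T)
  then have "(\<Otimes>j\<in>insert j T. f j) = f j \<otimes> (\<Otimes>j\<in>T. f j)"
    using f by (intro finprod_insert) auto
  then show ?case
    using insert by (simp add: generate.incl generate.eng)
qed (auto intro: generate.one)

text \<open>
  The quotient by \<open>K\<close> inherits finiteness and exponent two, so \<open>\<rho>\<close> is the projection followed by an
  isomorphism of the quotient with some \<open>Z2pow r\<close>.  Lagrange's theorem supplies the order formula,
  which serves to bound \<open>r\<close>.
\<close>

lemma (in comm_group) subgroup_eq_kernel_Z2pow:
  assumes fin: "finite (carrier G)" and exp2: "\<And>x. x \<in> carrier G \<Longrightarrow> x \<otimes> x = \<one>"
    and K: "subgroup K G"
  shows "\<exists>r \<rho>. \<rho> \<in> epi G (Z2pow r) \<and> \<rho> \<in> extensional (carrier G) \<and>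
               kernel G (Z2pow r) \<rho> = K \<and> 2 ^ r * card K = order G"
proof -
  interpret K: normal K G
    using K by (rule subgroup_imp_normal)
  interpret Q: comm_group "G Mod K"
    using K by (rule abelian_FactGroup)
  have proj: "(\<lambda>x. K #> x) \<in> hom G (G Mod K)"
    by (rule K.r_coset_hom_Mod)
  have surj: "(\<lambda>x. K #> x) ` carrier G = carrier (G Mod K)"
    by (auto simp: FactGroup_def RCOSETS_def)
  have "finite (carrier (G Mod K))"
    using fin surj by (metis finite_imageI)
  moreover have "C \<otimes>\<^bsub>G Mod K\<^esub> C = \<one>\<^bsub>G Mod K\<^esub>" if C: "C \<in> carrier (G Mod K)" for C
  proof -
    obtain x where x: "x \<in> carrier G" "C = K #> x"
      using C surj by blast
    have "C \<otimes>\<^bsub>G Mod K\<^esub> C = K #> (x \<otimes> x)"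
      using hom_mult[OF proj, of x x] x by simp
    then show ?thesis
      using exp2[OF x(1)] K.subset by (simp add: FactGroup_def)
  qed
  ultimately obtain r \<phi> where phi: "\<phi> \<in> iso (Z2pow r) (G Mod K)"
    using Q.exponent_two_iso_Z2pow by blast
  define \<theta> where "\<theta> = inv_into (carrier (Z2pow r)) \<phi>"
  have theta: "\<theta> \<in> iso (G Mod K) (Z2pow r)"
    unfolding \<theta>_def using phi by (rule group.iso_set_sym[OF group_Z2pow])
  then have theta_hom: "\<theta> \<in> hom (G Mod K) (Z2pow r)"
    and theta_bij: "bij_betw \<theta> (carrier (G Mod K)) (carrier (Z2pow r))"
    by (auto simp: iso_def)
  define \<rho> where "\<rho> = (\<lambda>x\<in>carrier G. \<theta> (K #> x))"
  have "(\<theta> \<circ> (\<lambda>x. K #> x)) \<in> hom G (Z2pow r)"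
    using proj theta_hom by (rule Group.hom_compose)
  then have hom: "\<rho> \<in> hom G (Z2pow r)"
    by (auto simp: \<rho>_def hom_def Pi_iff)
  have "\<rho> ` carrier G = \<theta> ` (\<lambda>x. K #> x) ` carrier G"
    by (auto simp: \<rho>_def image_image)
  also have "\<dots> = carrier (Z2pow r)"
    using theta_bij by (simp add: surj bij_betw_def)
  finally have epi: "\<rho> \<in> epi G (Z2pow r)"
    using hom by (simp add: epi_def)
  have theta_one: "\<theta> K = \<one>\<^bsub>Z2pow r\<^esub>"
    using hom_one[OF theta_hom Q.is_group group_Z2pow] by (simp add: FactGroup_def)
  have "\<rho> x = \<one>\<^bsub>Z2pow r\<^esub> \<longleftrightarrow> x \<in> K" if x: "x \<in> carrier G" for x
  proof -
    have "K #> x \<in> carrier (G Mod K)" "K \<in> carrier (G Mod K)"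
      using x surj Q.one_closed by (auto simp: FactGroup_def)
    then have "\<rho> x = \<one>\<^bsub>Z2pow r\<^esub> \<longleftrightarrow> K #> x = K"
      using theta_bij theta_one x by (auto simp: \<rho>_def bij_betw_def inj_on_def)
    also have "\<dots> \<longleftrightarrow> x \<in> K"
      using x K coset_join1 coset_join2 K.subset by metis
    finally show ?thesis .
  qed
  then have ker: "kernel G (Z2pow r) \<rho> = K"
    using K.subset by (auto simp: kernel_def)
  have "card (carrier (G Mod K)) = 2 ^ r"
    using bij_betw_same_card[OF theta_bij] by (simp add: card_carrier_Z2pow)
  then have "2 ^ r * card K = order G"
    using lagrange[OF K] by (simp add: FactGroup_def)
  then show ?thesis
    using epi ker by (intro exI[of _ r] exI[of _ \<rho>]) (simp add: \<rho>_def)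
qed

section \<open>Sign changes on the curve\<close>

definition flip :: "nat set \<Rightarrow> (nat \<Rightarrow> complex) \<Rightarrow> (nat \<Rightarrow> complex)" where
  "flip T x = (\<lambda>i. if i \<in> T then - x i else x i)"

text \<open>
  Indexing the elements of the Humbert group by sets of coordinates turns composition into
  symmetric difference, so that commutativity, exponent two and the bound on the order are
  all facts about sets.
\<close>

definition flip_map ::
    "nat \<Rightarrow> (nat \<Rightarrow> complex) \<Rightarrow> nat set \<Rightarrow> ((nat \<Rightarrow> complex) set \<Rightarrow> (nat \<Rightarrow> complex) set)" where
  "flip_map n lam T = (\<lambda>p\<in>humbert_curve n lam. flip T ` p)"

lemma flip_flip: "flip T (flip U x) = flip (sym_diff T U) x"
  by (auto simp: flip_def)

lemma std_gen_eq_flip_map: "std_gen n lam j = flip_map n lam {j}"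
proof -
  have "sign_change j = flip {j}"
    by (auto simp: sign_change_def flip_def fun_eq_iff)
  then show ?thesis
    by (simp add: std_gen_def flip_map_def)
qed

lemma flip_map_empty: "flip_map n lam {} = \<one>\<^bsub>BijGroup (humbert_curve n lam)\<^esub>"
  by (auto simp: flip_map_def BijGroup_def flip_def)

lemma mult_flip_map:
  assumes "flip_map n lam T \<in> carrier (BijGroup (humbert_curve n lam))"
    and "flip_map n lam U \<in> carrier (BijGroup (humbert_curve n lam))"
  shows "flip_map n lam T \<otimes>\<^bsub>BijGroup (humbert_curve n lam)\<^esub> flip_map n lam U =
           flip_map n lam (sym_diff T U)"
proof -
  have "flip_map n lam U p \<in> humbert_curve n lam" if "p \<in> humbert_curve n lam" for p
    using assms(2) that by (auto simp: BijGroup_def dest: Bij_imp_funcset)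
  then have "compose (humbert_curve n lam) (flip_map n lam T) (flip_map n lam U) =
               flip_map n lam (sym_diff T U)"
    by (auto simp: fun_eq_iff compose_def flip_map_def image_image flip_flip)
  then show ?thesis
    using assms by (simp add: BijGroup_def)
qed

lemma flip_map_in_BijGroup:
  assumes "T \<subseteq> {1..n+1}"
  shows "flip_map n lam T \<in> carrier (BijGroup (humbert_curve n lam))"
proof -
  interpret B: group "BijGroup (humbert_curve n lam)" by (rule group_BijGroup)
  have "finite T" using assms finite_subset by blast
  then show ?thesis
    using assms
  proof induction
    case empty
    then show ?case by (simp only: flip_map_empty B.one_closed)
  next
    case (insert j T)
    then have j: "flip_map n lam {j} \<in> carrier (BijGroup (humbert_curve n lam))"
      using std_gen_in_BijGroup[of j n lam] by (simp add: std_gen_eq_flip_map)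
    have "sym_diff {j} T = insert j T"
      using insert by auto
    then show ?case
      using mult_flip_map[OF j] insert B.m_closed[OF j] by (metis insert_subset)
  qed
qed

lemma negation_trivial:
  assumes "p \<in> proj_space n"
  shows "flip {1..n+1} ` p = p"
proof -
  obtain x where x: "x \<in> hom_coords n" and p: "p = proportional n `` {x}"
    using assms unfolding proj_space_def by (auto elim: quotientE)
  have neg: "flip {1..n+1} y \<in> p" if "y \<in> p" for y
  proof -
    have y: "y \<in> hom_coords n" and "\<exists>c. c \<noteq> 0 \<and> y = (\<lambda>i. c * x i)"
      using that by (auto simp: p proportional_def)
    then obtain c where c: "c \<noteq> 0" "y = (\<lambda>i. c * x i)"
      by blast
    have "flip {1..n+1} y = (\<lambda>i. - c * x i)"
      using x by (auto simp: flip_def c hom_coords_def)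
    moreover have "flip {1..n+1} y \<in> hom_coords n"
      using y by (auto simp: hom_coords_def flip_def)
    ultimately show ?thesis
      using x c(1) by (auto simp: p proportional_def intro: exI[of _ "-c"])
  qed
  have "y \<in> flip {1..n+1} ` p" if "y \<in> p" for y
  proof -
    have "y = flip {1..n+1} (flip {1..n+1} y)"
      by (auto simp: flip_def)
    then show ?thesis using neg[OF that] by blast
  qed
  then show ?thesis using neg by blast
qed

text \<open>The relation \<open>a\<^sub>1 a\<^sub>2 \<cdots> a\<^sub>n\<^sub>+\<^sub>1 = 1\<close>.\<close>

lemma flip_map_all: "flip_map n lam {1..n+1} = \<one>\<^bsub>BijGroup (humbert_curve n lam)\<^esub>"
  using negation_trivial by (auto simp: flip_map_def BijGroup_def humbert_curve_def fun_eq_iff simp del: One_nat_def)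

lemma carrier_humbert_group: "carrier (humbert_group n lam) = flip_map n lam ` Pow {1..n}"
proof -
  define B where "B = BijGroup (humbert_curve n lam)"
  interpret B: group B unfolding B_def by (rule group_BijGroup)
  have car: "flip_map n lam T \<in> carrier B" if "T \<subseteq> {1..n}" for T
    unfolding B_def using that by (intro flip_map_in_BijGroup) auto
  have mult: "flip_map n lam T \<otimes>\<^bsub>B\<^esub> flip_map n lam U = flip_map n lam (sym_diff T U)"
    if "T \<subseteq> {1..n}" "U \<subseteq> {1..n}" for T U
    using that car mult_flip_map[of n lam T U] by (simp add: B_def)
  have gens: "std_gen n lam ` {1..n} \<subseteq> carrier B"
    using car by (auto simp: std_gen_eq_flip_map)
  then have H: "carrier (humbert_group n lam) = generate B (std_gen n lam ` {1..n})"
    unfolding humbert_group_def B_def by (simp add: carrier_subgroup_generated Int_absorb1)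
  have "x \<in> flip_map n lam ` Pow {1..n}" if "x \<in> generate B (std_gen n lam ` {1..n})" for x
    using that
  proof (induction rule: generate.induct)
    case one
    have "\<one>\<^bsub>B\<^esub> = flip_map n lam {}" by (simp add: B_def flip_map_empty)
    then show ?case by blast
  next
    case (incl h)
    then show ?case by (auto simp: std_gen_eq_flip_map)
  next
    case (inv h)
    then obtain j where j: "j \<in> {1..n}" "h = flip_map n lam {j}"
      by (auto simp: std_gen_eq_flip_map)
    then have "h \<otimes>\<^bsub>B\<^esub> h = \<one>\<^bsub>B\<^esub>"
      using mult[of "{j}" "{j}"] flip_map_empty[of n lam] by (simp add: B_def)
    then have "inv\<^bsub>B\<^esub> h = h"
      using car[of "{j}"] j by (intro B.inv_equality) auto
    then show ?case using j by auto
  next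
    case (eng a b)
    then obtain T U where "T \<subseteq> {1..n}" "U \<subseteq> {1..n}" "a = flip_map n lam T" "b = flip_map n lam U"
      by blast
    moreover from this have "sym_diff T U \<subseteq> {1..n}" by blast
    ultimately show ?case using mult by blast
  qed
  moreover have "flip_map n lam T \<in> generate B (std_gen n lam ` {1..n})" if "T \<subseteq> {1..n}" for T
  proof -
    have "finite T" using that finite_subset by blast
    then show ?thesis
      using that
    proof induction
      case empty
      then show ?case by (simp add: flip_map_empty B_def generate.one)
    next
      case (insert j T)
      have "flip_map n lam (insert j T) = flip_map n lam {j} \<otimes>\<^bsub>B\<^esub> flip_map n lam T"
      proof -
        have "sym_diff {j} T = insert j T" using insert by auto
        then show ?thesis using mult[of "{j}" T] insert by simp
      qed
      moreover have "flip_map n lam {j} \<in> generate B (std_gen n lam ` {1..n})"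
        using insert by (intro generate.incl) (auto simp: std_gen_eq_flip_map)
      ultimately show ?case
        using insert by (simp add: generate.eng)
    qed
  qed
  ultimately show ?thesis unfolding H by blast
qed

lemma humbert_groupE:
  assumes "x \<in> carrier (humbert_group n lam)"
  obtains T where "T \<subseteq> {1..n+1}" "x = flip_map n lam T"
proof -
  obtain T where "T \<subseteq> {1..n}" "x = flip_map n lam T"
    using assms unfolding carrier_humbert_group by blast
  moreover from this have "T \<subseteq> {1..n+1}" by auto
  ultimately show thesis using that by blast
qed

lemma mult_humbert_group [simp]: "(\<otimes>\<^bsub>humbert_group n lam\<^esub>) = (\<otimes>\<^bsub>BijGroup (humbert_curve n lam)\<^esub>)"
  by (simp add: humbert_group_def subgroup_generated_def)

lemma one_humbert_group [simp]: "\<one>\<^bsub>humbert_group n lam\<^esub> = \<one>\<^bsub>BijGroup (humbert_curve n lam)\<^esub>"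
  by (simp add: humbert_group_def subgroup_generated_def)

lemma mult_flip_map_humbert_group:
  assumes "T \<subseteq> {1..n+1}" "U \<subseteq> {1..n+1}"
  shows "flip_map n lam T \<otimes>\<^bsub>humbert_group n lam\<^esub> flip_map n lam U = flip_map n lam (sym_diff T U)"
  using assms by (simp add: mult_flip_map flip_map_in_BijGroup)

text \<open>
  The group is generated by the first \<open>n\<close> sign changes only.  A set containing \<open>n + 1\<close> is replaced
  by its complement, which induces the same map because changing all signs is trivial.
\<close>

lemma flip_map_in_humbert_group:
  assumes "T \<subseteq> {1..n+1}"
  shows "flip_map n lam T \<in> carrier (humbert_group n lam)"
proof (cases "n + 1 \<in> T")
  case False
  then have "T \<subseteq> {1..n}" using assms by (force simp: subset_iff le_Suc_eq)
  then show ?thesis by (auto simp: carrier_humbert_group)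
next
  case True
  interpret B: group "BijGroup (humbert_curve n lam)" by (rule group_BijGroup)
  have "flip_map n lam T = flip_map n lam T \<otimes>\<^bsub>humbert_group n lam\<^esub> flip_map n lam {1..n+1}"
    using flip_map_in_BijGroup[OF assms] unfolding flip_map_all by simp
  also have "\<dots> = flip_map n lam (sym_diff T {1..n+1})"
    by (intro mult_flip_map_humbert_group assms order.refl)
  also have "sym_diff T {1..n+1} = {1..n} - T"
    using True assms by (auto simp: le_Suc_eq)
  finally show ?thesis by (auto simp: carrier_humbert_group)
qed

lemma std_gen_in_humbert_group:
  assumes "j \<in> {1..n+1}"
  shows "std_gen n lam j \<in> carrier (humbert_group n lam)"
  unfolding std_gen_eq_flip_map using assms by (intro flip_map_in_humbert_group) blast

lemma humbert_group_elementary_abelian: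
  shows "comm_group (humbert_group n lam)"
    and "x \<in> carrier (humbert_group n lam) \<Longrightarrow> x \<otimes>\<^bsub>humbert_group n lam\<^esub> x = \<one>\<^bsub>humbert_group n lam\<^esub>"
    and "finite (carrier (humbert_group n lam))"
    and "order (humbert_group n lam) \<le> 2 ^ n"
proof -
  have mult: "flip_map n lam T \<otimes>\<^bsub>humbert_group n lam\<^esub> flip_map n lam U = flip_map n lam (sym_diff T U)"
    if "T \<subseteq> {1..n}" "U \<subseteq> {1..n}" for T U
    using that by (intro mult_flip_map_humbert_group) auto
  have "group (humbert_group n lam)"
    unfolding humbert_group_def by (rule group.group_subgroup_generated[OF group_BijGroup])
  then show "comm_group (humbert_group n lam)"
  proof (rule group.group_comm_groupI)
    fix x y assume "x \<in> carrier (humbert_group n lam)" "y \<in> carrier (humbert_group n lam)"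
    then obtain T U where "T \<subseteq> {1..n}" "U \<subseteq> {1..n}" "x = flip_map n lam T" "y = flip_map n lam U"
      by (auto simp: carrier_humbert_group)
    then show "x \<otimes>\<^bsub>humbert_group n lam\<^esub> y = y \<otimes>\<^bsub>humbert_group n lam\<^esub> x"
      using mult[of T U] mult[of U T] by (simp add: Un_commute)
  qed
  show "x \<otimes>\<^bsub>humbert_group n lam\<^esub> x = \<one>\<^bsub>humbert_group n lam\<^esub>"
    if x: "x \<in> carrier (humbert_group n lam)"
  proof -
    obtain T where "T \<subseteq> {1..n}" "x = flip_map n lam T"
      using x by (auto simp: carrier_humbert_group)
    then show ?thesis
      using mult[of T T] by (simp add: flip_map_empty)
  qed
  show "finite (carrier (humbert_group n lam))"
    by (simp add: carrier_humbert_group)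
  show "order (humbert_group n lam) \<le> 2 ^ n"
    using card_image_le[of "Pow {1..n}" "flip_map n lam"]
    by (simp add: order_def carrier_humbert_group card_Pow)
qed

section \<open>Fixed points of the standard generators\<close>

text \<open>
  The squares of all coordinates are determined by the first two coordinates, which may be
  prescribed arbitrarily.
\<close>

definition curve_vector :: "nat \<Rightarrow> (nat \<Rightarrow> complex) \<Rightarrow> complex \<Rightarrow> complex \<Rightarrow> nat \<Rightarrow> complex" where
  "curve_vector n lam a b i =
     (if i = 1 then a else if i = 2 then b
      else if i = 3 then csqrt (- (a\<^sup>2 + b\<^sup>2))
      else if i \<in> {4..n+1} then csqrt (- (lam (i - 3) * a\<^sup>2 + b\<^sup>2)) else 0)"

lemma curve_vector_on_curve:
  assumes "n \<ge> 2" and "a \<noteq> 0 \<or> b \<noteq> 0"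
  shows "curve_vector n lam a b \<in> hom_coords n"
    and "curve_equations n lam (curve_vector n lam a b)"
proof -
  have "curve_vector n lam a b 1 \<noteq> 0 \<or> curve_vector n lam a b 2 \<noteq> 0"
    using assms(2) by (simp add: curve_vector_def)
  moreover have "1 \<in> {1..n+1}" "2 \<in> {1..n+1}" using assms(1) by auto
  ultimately have "\<exists>i\<in>{1..n+1}. curve_vector n lam a b i \<noteq> 0" by blast
  then show "curve_vector n lam a b \<in> hom_coords n"
    using assms(1) by (auto simp: hom_coords_def curve_vector_def)
  show "curve_equations n lam (curve_vector n lam a b)"
    using assms(1) by (auto simp: curve_equations_def curve_vector_def)
qed

lemma class_in_humbert_curve:
  assumes "x \<in> hom_coords n" "curve_equations n lam x"
  shows "proportional n `` {x} \<in> humbert_curve n lam"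
proof -
  have "curve_equations n lam (\<lambda>i. c * x i)" for c
  proof -
    have "(c * x 1)\<^sup>2 + (c * x 2)\<^sup>2 + (c * x 3)\<^sup>2 = c\<^sup>2 * ((x 1)\<^sup>2 + (x 2)\<^sup>2 + (x 3)\<^sup>2)"
      by (simp add: algebra_simps power_mult_distrib)
    moreover have "lam j * (c * x 1)\<^sup>2 + (c * x 2)\<^sup>2 + (c * x (j + 3))\<^sup>2 =
                     c\<^sup>2 * (lam j * (x 1)\<^sup>2 + (x 2)\<^sup>2 + (x (j + 3))\<^sup>2)" for j
      by (simp add: algebra_simps power_mult_distrib)
    ultimately show ?thesis
      using assms(2) by (simp add: curve_equations_def)
  qed
  then have "\<forall>y\<in>proportional n `` {x}. curve_equations n lam y"
    by (auto simp: proportional_def)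
  then show ?thesis
    using assms(1) by (auto simp: humbert_curve_def proj_space_def intro: quotientI)
qed

text \<open>
  A representative with \<open>x\<^sub>j = 0\<close> is unchanged by the sign change, and so are all its multiples.
  The first two coordinates are chosen to make the \<open>j\<close>-th coordinate vanish.
\<close>

lemma std_gen_has_fixed_point:
  assumes n: "n \<ge> 2" and j: "j \<in> {1..n+1}"
  shows "\<exists>p\<in>humbert_curve n lam. std_gen n lam j p = p"
proof -
  define a :: complex where "a = (if j = 1 then 0 else 1)"
  define b :: complex where
    "b = (if j = 1 then 1 else if j = 2 then 0 else if j = 3 then \<i> else csqrt (- lam (j - 3)))"
  define x where "x = curve_vector n lam a b"
  have x: "x \<in> hom_coords n" "curve_equations n lam x"
    unfolding x_def by (rule curve_vector_on_curve[OF n]; simp add: a_def b_def)+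
  have xj: "x j = 0"
    using j by (simp add: x_def curve_vector_def a_def b_def)
  have "sign_change j y = y" if "y \<in> proportional n `` {x}" for y
    using that xj by (auto simp: proportional_def sign_change_def)
  then have "sign_change j ` (proportional n `` {x}) = proportional n `` {x}"
    by simp
  then show ?thesis
    using class_in_humbert_curve[OF x]
    by (intro bexI[of _ "proportional n `` {x}"]) (simp_all add: std_gen_def)
qed

text \<open>
  At a point without zero coordinates, the sign change at \<open>j\<close> would have to act as a scalar that is
  \<open>-1\<close> at \<open>j\<close> and \<open>1\<close> at every other coordinate.
\<close>

lemma std_gen_nontrivial:
  assumes n: "n \<ge> 2" and j: "j \<in> {1..n+1}"
  shows "std_gen n lam j \<noteq> \<one>\<^bsub>BijGroup (humbert_curve n lam)\<^esub>"
proof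
  assume triv: "std_gen n lam j = \<one>\<^bsub>BijGroup (humbert_curve n lam)\<^esub>"
  \<comment> \<open>With \<open>x\<^sub>1 = 1\<close> and \<open>x\<^sub>2\<^sup>2 = t\<close>, these finitely many \<open>t\<close> are the ones for which a coordinate vanishes.\<close>
  have "finite ({0, - 1} \<union> (\<lambda>i. - lam (i - 3)) ` {4..n+1})" by simp
  then obtain t where "t \<notin> {0, - 1} \<union> (\<lambda>i. - lam (i - 3)) ` {4..n+1}"
    using ex_new_if_finite[OF infinite_UNIV_char_0] by metis
  then have t: "t \<noteq> 0" "t \<noteq> - 1" "\<And>i. i \<in> {4..n+1} \<Longrightarrow> t \<noteq> - lam (i - 3)"
    by auto
  define x where "x = curve_vector n lam 1 (csqrt t)"
  have x: "x \<in> hom_coords n" "curve_equations n lam x"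
    unfolding x_def by (rule curve_vector_on_curve[OF n]; simp)+
  have nz: "x i \<noteq> 0" if "i \<in> {1..n+1}" for i
  proof -
    have "1 + t \<noteq> 0" using t(2) by (simp add: add_eq_0_iff)
    moreover have "lam (i - 3) + t \<noteq> 0" if "i \<in> {4..n+1}"
      using t(3)[OF that] by (simp add: add_eq_0_iff)
    moreover have "i \<in> {4..n+1}" if "i \<noteq> 1" "i \<noteq> 2" "i \<noteq> 3"
      using that \<open>i \<in> {1..n+1}\<close> by auto
    ultimately show ?thesis
      using t(1) unfolding x_def curve_vector_def
      by (simp del: minus_add_distrib add: neg_eq_iff_add_eq_0)
  qed
  define p where "p = proportional n `` {x}"
  have p: "p \<in> humbert_curve n lam"
    unfolding p_def using class_in_humbert_curve[OF x] .
  have "sign_change j ` p = p"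
    using fun_cong[OF triv, of p] p by (simp add: std_gen_def BijGroup_def)
  moreover have "x \<in> p"
    using x by (auto simp: p_def proportional_def intro: exI[of _ 1])
  ultimately have "sign_change j x \<in> p" by blast
  then obtain c where c: "sign_change j x = (\<lambda>i. c * x i)"
    by (auto simp: p_def proportional_def)
  obtain i where i: "i \<in> {1..n+1}" "i \<noteq> j"
    using n that[of 1] that[of 2] by (cases "j = 1") auto
  have "c = 1"
    using fun_cong[OF c, of i] i nz[of i] by (simp add: sign_change_def)
  then show False
    using fun_cong[OF c, of j] j nz[of j] by (simp add: sign_change_def)
qed

section \<open>From homomorphisms to partitions\<close>

text \<open>
  Here \<open>v j\<close> stands for the image of the \<open>j\<close>-th standard generator.  Grouping the product of all
  \<open>v j\<close> by their value turns it into the product of the powers \<open>u\<^sub>k ^ #I\<^sub>k\<close>.  The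
  label \<open>u\<^sub>0 = \<one>\<close> is not among those of the partition, so the fibres cover all indices exactly
  because no \<open>v j\<close> is neutral.
\<close>

lemma fibres_in_part_family:
  assumes enum: "enumerates_Z2pow r u"
    and v: "v \<in> {1..n+1} \<rightarrow> carrier (Z2pow r)"
    and nz: "\<And>j. j \<in> {1..n+1} \<Longrightarrow> v j \<noteq> \<one>\<^bsub>Z2pow r\<^esub>"
    and prod: "(\<Otimes>\<^bsub>Z2pow r\<^esub>j\<in>{1..n+1}. v j) = \<one>\<^bsub>Z2pow r\<^esub>"
    and gen: "generate (Z2pow r) (v ` {1..n+1}) = carrier (Z2pow r)"
  shows "(\<lambda>k\<in>{1..2^r - 1}. {j \<in> {1..n+1}. v j = u k}) \<in> part_family n r u"
proof -
  interpret Z: comm_group "Z2pow r" by (rule comm_group_Z2pow)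
  define I :: "nat set" where "I = {1..2^r - 1}"
  define F where "F k = {j \<in> {1..n+1}. v j = u k}" for k
  have u: "inj_on u {0..2^r - 1}" "u ` {0..2^r - 1} = carrier (Z2pow r)" "u 0 = \<one>\<^bsub>Z2pow r\<^esub>"
    using enum by (auto simp: enumerates_Z2pow_def bij_betw_def)
  have uI: "u k \<in> carrier (Z2pow r)" if "k \<in> I" for k
    using that u(2) by (auto simp: I_def)
  have ex: "\<exists>k\<in>I. v j = u k" if "j \<in> {1..n+1}" for j
  proof -
    have "v j \<in> u ` {0..2^r - 1}" using v that u(2) by auto
    then obtain k where k: "k \<in> {0..2^r - 1}" "v j = u k" by blast
    then have "k \<noteq> 0" using nz[OF that] u(3) by metis
    then show ?thesis using k by (auto simp: I_def)
  qed
  have disj: "F k \<inter> F l = {}" if "k \<in> I" "l \<in> I" "k \<noteq> l" for k l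
  proof -
    have "u k \<noteq> u l"
      using inj_onD[OF u(1), of k l] that by (auto simp: I_def)
    then show ?thesis by (auto simp: F_def)
  qed
  have finI: "finite I" and finF: "finite (F k)" for k
    by (simp_all add: I_def F_def)
  have vF: "v j \<in> carrier (Z2pow r)" if "j \<in> F k" for j k
    using funcset_mem[OF v, of j] that unfolding F_def by blast
  have cover: "(\<Union>k\<in>I. F k) = {1..n+1}"
    using ex by (fastforce simp: F_def)
  have "(\<Otimes>\<^bsub>Z2pow r\<^esub>k\<in>I. u k [^]\<^bsub>Z2pow r\<^esub> card (F k)) =
          (\<Otimes>\<^bsub>Z2pow r\<^esub>k\<in>I. \<Otimes>\<^bsub>Z2pow r\<^esub>j\<in>F k. v j)"
  proof (rule Z.finprod_cong')
    show "u k [^]\<^bsub>Z2pow r\<^esub> card (F k) = (\<Otimes>\<^bsub>Z2pow r\<^esub>j\<in>F k. v j)" if "k \<in> I" for k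
    proof -
      have "(\<Otimes>\<^bsub>Z2pow r\<^esub>j\<in>F k. v j) = (\<Otimes>\<^bsub>Z2pow r\<^esub>j\<in>F k. u k)"
        using uI[OF that] by (intro Z.finprod_cong') (auto simp: F_def)
      then show ?thesis using Z.finprod_const[OF uI[OF that], of "F k"] by simp
    qed
  qed (use vF in \<open>auto intro!: Z.finprod_closed\<close>)
  also have "\<dots> = (\<Otimes>\<^bsub>Z2pow r\<^esub>j\<in>(\<Union>k\<in>I. F k). v j)"
    by (rule Z.finprod_UN_disjoint[symmetric])
       (use finI finF disj vF in \<open>auto simp: pairwise_def disjnt_def\<close>)
  also have "\<dots> = \<one>\<^bsub>Z2pow r\<^esub>" unfolding cover by (rule prod)
  finally have weights: "(\<Otimes>\<^bsub>Z2pow r\<^esub>k\<in>I. u k [^]\<^bsub>Z2pow r\<^esub> card (F k)) = \<one>\<^bsub>Z2pow r\<^esub>" .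
  have weights': "(\<Otimes>\<^bsub>Z2pow r\<^esub>k\<in>I. u k [^]\<^bsub>Z2pow r\<^esub> card (restrict F I k)) = \<one>\<^bsub>Z2pow r\<^esub>"
  proof -
    have "(\<Otimes>\<^bsub>Z2pow r\<^esub>k\<in>I. u k [^]\<^bsub>Z2pow r\<^esub> card (restrict F I k)) =
            (\<Otimes>\<^bsub>Z2pow r\<^esub>k\<in>I. u k [^]\<^bsub>Z2pow r\<^esub> card (F k))"
      using uI by (intro Z.finprod_cong') auto
    then show ?thesis using weights by simp
  qed
  have "{u k |k. k \<in> I \<and> restrict F I k \<noteq> {}} = v ` {1..n+1}"
  proof (intro equalityI subsetI)
    fix z assume "z \<in> {u k |k. k \<in> I \<and> restrict F I k \<noteq> {}}"
    then obtain k where k: "z = u k" "k \<in> I" "restrict F I k \<noteq> {}"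
      by blast
    then have "F k \<noteq> {}" by simp
    then obtain j where j: "j \<in> F k" by blast
    have "z = v j" "j \<in> {1..n+1}" using j k(1) by (simp_all add: F_def)
    then show "z \<in> v ` {1..n+1}" by (rule image_eqI)
  next
    fix z assume "z \<in> v ` {1..n+1}"
    then obtain j where j: "z = v j" "j \<in> {1..n+1}" by (rule imageE)
    obtain k where k: "k \<in> I" "v j = u k" using ex[OF j(2)] by (rule bexE)
    have "j \<in> restrict F I k" using j k by (simp add: F_def)
    then have "z = u k" "k \<in> I" "restrict F I k \<noteq> {}"
      using j k by auto
    then show "z \<in> {u k |k. k \<in> I \<and> restrict F I k \<noteq> {}}"
      by blast
  qed
  then have "generate (Z2pow r) {u k |k. k \<in> I \<and> restrict F I k \<noteq> {}} = carrier (Z2pow r)"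
    using gen by simp
  moreover have "restrict F I \<in> I \<rightarrow>\<^sub>E Pow {1..n+1}"
    by (auto simp: F_def)
  moreover have "disjoint_family_on (restrict F I) I"
    using disj by (auto simp: disjoint_family_on_def)
  moreover have "(\<Union>k\<in>I. restrict F I k) = {1..n+1}"
    using cover by auto
  ultimately show ?thesis
    using weights' by (simp only: part_family_def I_def F_def[abs_def] mem_Collect_eq simp_thms)
qed

text \<open>
  In particular a homomorphism is determined by its values on the standard generators, and at
  \<open>T = {1..n+1}\<close> the left-hand side is neutral.
\<close>

lemma hom_flip_map:
  assumes hom: "\<rho> \<in> hom (humbert_group n lam) Z" and Z: "comm_group Z" and T: "T \<subseteq> {1..n+1}"
  shows "\<rho> (flip_map n lam T) = (\<Otimes>\<^bsub>Z\<^esub>j\<in>T. \<rho> (std_gen n lam j))"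
proof -
  interpret Z: comm_group Z by (rule Z)
  have H: "group (humbert_group n lam)"
    using humbert_group_elementary_abelian(1) by (rule comm_group.axioms(2))
  have mem: "\<rho> (std_gen n lam j) \<in> carrier Z" if "j \<in> {1..n+1}" for j
    using hom_in_carrier[OF hom std_gen_in_humbert_group[OF that]] .
  have "finite T" using T finite_subset by blast
  then show ?thesis
    using T
  proof induction
    case empty
    then show ?case
      using hom_one[OF hom H Z.is_group] by (simp add: flip_map_empty)
  next
    case (insert j T)
    have "sym_diff {j} T = insert j T" using insert by auto
    then have "flip_map n lam (insert j T) =
                 flip_map n lam {j} \<otimes>\<^bsub>humbert_group n lam\<^esub> flip_map n lam T"
      using insert mult_flip_map_humbert_group[of "{j}" n T lam] by simp
    then have "\<rho> (flip_map n lam (insert j T)) = \<rho> (flip_map n lam {j}) \<otimes>\<^bsub>Z\<^esub> \<rho> (flip_map n lam T)"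
      using hom_mult[OF hom] flip_map_in_humbert_group[of "{j}" n lam]
        flip_map_in_humbert_group[of T n lam] insert by (metis empty_subsetI insert_subset)
    then show ?case
      using insert mem by (subst Z.finprod_insert) (auto simp: std_gen_eq_flip_map[symmetric])
  qed
qed

text \<open>
  This identifies the definite description: the sets \<open>P k\<close> cover all indices, so the labels prescribe
  the value at every standard generator, and two extensional homomorphisms with these values
  coincide by \<open>hom_flip_map\<close>.
\<close>

lemma part_hom_eqI:
  assumes epi: "\<rho> \<in> epi (humbert_group n lam) (Z2pow r)"
    and ext: "\<rho> \<in> extensional (carrier (humbert_group n lam))"
    and cover: "(\<Union>k\<in>{1..2^r - 1}. P k) = {1..n+1}"
    and val: "\<And>k j. k \<in> {1..2^r - 1} \<Longrightarrow> j \<in> P k \<Longrightarrow> \<rho> (std_gen n lam j) = u k"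
  shows "part_hom n lam r u P = \<rho>"
  unfolding part_hom_def
proof (rule the_equality)
  show "\<rho> \<in> epi (humbert_group n lam) (Z2pow r) \<and> \<rho> \<in> extensional (carrier (humbert_group n lam)) \<and>
          (\<forall>k\<in>{1..2^r - 1}. \<forall>j\<in>P k. \<rho> (std_gen n lam j) = u k)"
    using epi ext val by blast
next
  fix f
  assume f: "f \<in> epi (humbert_group n lam) (Z2pow r) \<and> f \<in> extensional (carrier (humbert_group n lam)) \<and>
          (\<forall>k\<in>{1..2^r - 1}. \<forall>j\<in>P k. f (std_gen n lam j) = u k)"
  have gens: "f (std_gen n lam j) = \<rho> (std_gen n lam j)" if j: "j \<in> {1..n+1}" for j
  proof -
    obtain k where "k \<in> {1..2^r - 1}" "j \<in> P k"
      using j cover by blast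
    then show ?thesis using f val by simp
  qed
  have "f x = \<rho> x" if x: "x \<in> carrier (humbert_group n lam)" for x
  proof -
    obtain T where T: "T \<subseteq> {1..n+1}" "x = flip_map n lam T"
      using x by (rule humbert_groupE)
    interpret Z: comm_group "Z2pow r" by (rule comm_group_Z2pow)
    have homs: "f \<in> hom (humbert_group n lam) (Z2pow r)" "\<rho> \<in> hom (humbert_group n lam) (Z2pow r)"
      using f epi by (auto simp: epi_def)
    have mem: "\<rho> (std_gen n lam j) \<in> carrier (Z2pow r)" if "j \<in> T" for j
    proof -
      have "j \<in> {1..n+1}" using that T by blast
      then show ?thesis
        by (intro hom_in_carrier[OF homs(2)] std_gen_in_humbert_group)
    qed
    have "f x = (\<Otimes>\<^bsub>Z2pow r\<^esub>j\<in>T. f (std_gen n lam j))"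
      unfolding T(2) by (rule hom_flip_map[OF homs(1) comm_group_Z2pow T(1)])
    also have "\<dots> = (\<Otimes>\<^bsub>Z2pow r\<^esub>j\<in>T. \<rho> (std_gen n lam j))"
      using gens mem T by (intro Z.finprod_cong') auto
    also have "\<dots> = \<rho> x"
      unfolding T(2) by (rule hom_flip_map[OF homs(2) comm_group_Z2pow T(1), symmetric])
    finally show ?thesis .
  qed
  then show "f = \<rho>"
    using f ext by (blast intro: extensionalityI)
qed

theorem theorem1:
  fixes n :: nat
    and lam :: "nat \<Rightarrow> complex"
    and u :: "nat \<Rightarrow> nat \<Rightarrow> (nat \<Rightarrow> int)"
    and K :: "((nat \<Rightarrow> complex) set \<Rightarrow> (nat \<Rightarrow> complex) set) set"
  assumes "n \<ge> 4"
    and "\<forall>i\<in>{1..n-2}. lam i \<notin> {0, 1}"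
    and "inj_on lam {1..n-2}"
    and "\<forall>r\<in>{1..n-1}. enumerates_Z2pow r (u r)"
    and "subgroup K (humbert_group n lam)"
    and "K \<noteq> {\<one>\<^bsub>humbert_group n lam\<^esub>}"
    and "acts_freely K (humbert_curve n lam)"
  shows "\<exists>r\<in>admissible_ranks n u. \<exists>P\<in>part_family n r (u r). K = part_kernel n lam r (u r) P"
proof -
  define H where "H = humbert_group n lam"
  define a where "a = std_gen n lam"
  interpret H: comm_group H
    unfolding H_def by (rule humbert_group_elementary_abelian(1))
  have K: "subgroup K H" using assms(5) by (simp add: H_def)
  have finH: "finite (carrier H)"
    unfolding H_def by (rule humbert_group_elementary_abelian(3))
  have a_mem: "a j \<in> carrier H" if "j \<in> {1..n+1}" for j
    unfolding a_def H_def using that by (rule std_gen_in_humbert_group)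
  have a_notin: "a j \<notin> K" if "j \<in> {1..n+1}" for j
    using std_gen_has_fixed_point[of n j lam] std_gen_nontrivial[of n j lam] that assms(1,7)
    by (auto simp: acts_freely_def a_def)
  obtain r \<rho> where epi: "\<rho> \<in> epi H (Z2pow r)" and ext: "\<rho> \<in> extensional (carrier H)"
    and ker: "kernel H (Z2pow r) \<rho> = K" and ord: "2 ^ r * card K = order H"
    using H.subgroup_eq_kernel_Z2pow[OF finH _ K] humbert_group_elementary_abelian(2)
    unfolding H_def by blast
  interpret Z: comm_group "Z2pow r" by (rule comm_group_Z2pow)
  have hom: "\<rho> \<in> hom H (Z2pow r)" and surj: "\<rho> ` carrier H = carrier (Z2pow r)"
    using epi by (auto simp: epi_def)
  interpret rho: group_hom H "Z2pow r" \<rho>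
    using hom by unfold_locales
  have nz: "\<rho> (a j) \<noteq> \<one>\<^bsub>Z2pow r\<^esub>" if "j \<in> {1..n+1}" for j
    using a_notin[OF that] a_mem[OF that] ker by (auto simp: kernel_def)
  have r: "r \<in> {1..n-1}"
  proof -
    \<comment> \<open>\<open>Z2pow 0\<close> is trivial, but \<open>\<rho>\<close> is non-trivial at \<open>a 1\<close>.\<close>
    have "r \<noteq> 0"
    proof
      assume "r = 0"
      then have "\<rho> (a 1) = \<one>\<^bsub>Z2pow r\<^esub>"
        using rho.hom_closed[OF a_mem[of 1]] Z.one_closed by (auto simp: carrier_Z2pow)
      then show False using nz[of 1] by simp
    qed
    moreover have "r < n"
    proof -
      have "finite K" using finH K by (meson finite_subset subgroup.subset)
      moreover have "\<one>\<^bsub>H\<^esub> \<in> K" using K by (rule subgroup.one_closed)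
      moreover have "K \<noteq> {\<one>\<^bsub>H\<^esub>}" using assms(6) by (simp add: H_def)
      ultimately have "card K \<ge> 2"
        by (metis One_nat_def card_1_singletonE card_gt_0_iff empty_iff less_2_cases_iff
            not_less not_less_zero singletonD)
      then have "2 ^ r * 2 \<le> (2::nat) ^ r * card K" by simp
      also have "\<dots> \<le> 2 ^ n"
        unfolding ord H_def by (rule humbert_group_elementary_abelian(4))
      finally have "(2::nat) ^ Suc r \<le> 2 ^ n" by simp
      then have "Suc r \<le> n" by (simp only: power_increasing_iff one_less_numeral_iff semiring_norm)
      then show ?thesis by simp
    qed
    ultimately show ?thesis by auto
  qed
  have prod: "(\<Otimes>\<^bsub>Z2pow r\<^esub>j\<in>{1..n+1}. \<rho> (a j)) = \<one>\<^bsub>Z2pow r\<^esub>"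
    using hom_flip_map[OF hom[unfolded H_def] comm_group_Z2pow order.refl] rho.hom_one
    unfolding flip_map_all by (simp add: a_def H_def)
  \<comment> \<open>Every element of \<open>Z2pow r\<close> is the image of a set of sign changes, hence a product of labels.\<close>
  have gen: "generate (Z2pow r) ((\<lambda>j. \<rho> (a j)) ` {1..n+1}) = carrier (Z2pow r)"
  proof
    show "generate (Z2pow r) ((\<lambda>j. \<rho> (a j)) ` {1..n+1}) \<subseteq> carrier (Z2pow r)"
      using a_mem by (intro Z.generate_incl) auto
    show "carrier (Z2pow r) \<subseteq> generate (Z2pow r) ((\<lambda>j. \<rho> (a j)) ` {1..n+1})"
    proof
      fix z assume "z \<in> carrier (Z2pow r)"
      then obtain x where x: "x \<in> carrier H" "z = \<rho> x"
        using surj by blast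
      obtain T where "T \<subseteq> {1..n+1}" "x = flip_map n lam T"
        using x(1) unfolding H_def by (rule humbert_groupE)
      then have T: "T \<subseteq> {1..n+1}" "z = \<rho> (flip_map n lam T)"
        using x(2) by auto
      then have "z = (\<Otimes>\<^bsub>Z2pow r\<^esub>j\<in>T. \<rho> (a j))"
        using hom_flip_map[OF hom[unfolded H_def] comm_group_Z2pow] by (simp add: a_def)
      then show "z \<in> generate (Z2pow r) ((\<lambda>j. \<rho> (a j)) ` {1..n+1})"
        using a_mem T by (auto intro!: Z.finprod_in_generate)
    qed
  qed
  define P where "P = (\<lambda>k\<in>{1..2^r - 1}. {j \<in> {1..n+1}. \<rho> (a j) = u r k})"
  have P: "P \<in> part_family n r (u r)"
    unfolding P_def
    using assms(4) r a_mem nz prod gen by (intro fibres_in_part_family) auto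
  then have cover: "(\<Union>k\<in>{1..2^r - 1}. P k) = {1..n+1}"
    by (simp add: part_family_def)
  have "part_hom n lam r (u r) P = \<rho>"
    using epi ext cover by (intro part_hom_eqI) (auto simp: P_def H_def a_def)
  then have "K = part_kernel n lam r (u r) P"
    using ker by (simp add: part_kernel_def H_def)
  moreover have "r \<in> admissible_ranks n u"
    using r P by (auto simp: admissible_ranks_def)
  ultimately show ?thesis
    using P by blast
qed

end
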